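(* Let $\mathcal H$ be a real Hilbert space, $C\subseteq\mathcal H$ nonempty closed convex, and let $B\colon\mathcal H\to\mathcal H$ be monotone and $L$-Lipschitz ($L>0$) with $S\neq\varnothing$. Let $\lambda_0\in(0,\tfrac1{5L}]$, $\lambda_{\min}\in(0,\lambda_0)$, and let $(\lambda_k)_{k\ge0}$ satisfy $$0<\lambda_{\min}\le\lambda_k\le\lambda_0\ \ \forall k,\qquad \sum_k|\lambda_k-\lambda_{k-1}|<\infty$$ (no monotonicity of $(\lambda_k)$ is required). Let $0\le\beta_k\le\tfrac14$, $\sum_k\beta_k<\infty$, $\theta_k=1-\beta_k$, $x_{-1}=x_0=u_0\in C$, and define $$x_{k+1}=P_C\bigl(x_k-\lambda_kB(u_k)\bigr)\quad(k\ge0),\qquad u_k=x_k+\theta_k(x_k-x_{k-1})+\beta_k(x_k-u_{k-1})\quad(k\ge1).$$ Then $(x_k)$ converges weakly to a point of $S$, with $\|x_{k+1}-x_k\|\to0$ and $\|u_k-x_k\|\to0$.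
   Context: $P_C$ is the metric projection onto $C$. Monotone means $\langle B(x)-B(y),x-y\rangle\ge0$ for all $x,y\in\mathcal H$; $L$-Lipschitz means $\|B(x)-B(y)\|\le L\|x-y\|$. The solution set is $S=\{z\in C:\langle B(z),x-z\rangle\ge0\ \forall x\in C\}$. Convention: $\lambda_{-1}=\lambda_0$. *)

theory Defs
  imports "HOL-Analysis.Analysis"
begin

text \<open>A real Hilbert space is a type of sort \<open>{real_inner, complete_space}\<close>.\<close>

text \<open>The library's \<open>closest_point\<close> requires the sort \<open>heine_borel\<close>, which excludes
  infinite-dimensional spaces. The description below is meaningful when \<open>C\<close> is nonempty, closed
  and convex in a Hilbert space, where the minimiser exists and is unique.\<close>

definition metric_proj :: "'a::metric_space set \<Rightarrow> 'a \<Rightarrow> 'a"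
  where "metric_proj C x = (THE p. p \<in> C \<and> (\<forall>y\<in>C. dist x p \<le> dist x y))"

definition monotone_operator :: "('a::real_inner \<Rightarrow> 'a) \<Rightarrow> bool"
  where "monotone_operator B \<longleftrightarrow> (\<forall>x y. inner (B x - B y) (x - y) \<ge> 0)"

definition VI_solutions :: "('a::real_inner \<Rightarrow> 'a) \<Rightarrow> 'a set \<Rightarrow> 'a set"
  where "VI_solutions B C = {z \<in> C. \<forall>x\<in>C. inner (B z) (x - z) \<ge> 0}"

definition converges_weakly :: "(nat \<Rightarrow> 'a::real_normed_vector) \<Rightarrow> 'a \<Rightarrow> bool"
  where "converges_weakly x z \<longleftrightarrow>
    (\<forall>f :: 'a \<Rightarrow> real. bounded_linear f \<longrightarrow> (\<lambda>k. f (x k)) \<longlonglongrightarrow> f z)"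

end

theory Submission
  imports Defs
begin

text \<open>Writing \<open>u\<^sub>k = 2 x\<^sub>k - x\<^sub>k\<^sub>-\<^sub>1 + \<beta>\<^sub>k (x\<^sub>k\<^sub>-\<^sub>1 - u\<^sub>k\<^sub>-\<^sub>1)\<close> exhibits the scheme as a projected
  reflected gradient method perturbed by summable relative errors. For \<open>z \<in> S\<close> the energy
  \<open>E\<^sub>k = \<parallel>x\<^sub>k\<^sub>+\<^sub>1 - z\<parallel>\<^sup>2 + 1/5 \<parallel>x\<^sub>k\<^sub>+\<^sub>1 - u\<^sub>k\<parallel>\<^sup>2 + 1/10 \<parallel>x\<^sub>k\<^sub>+\<^sub>1 - x\<^sub>k\<parallel>\<^sup>2 + 2 \<lambda>\<^sub>k \<langle>B z, x\<^sub>k - z\<rangle>\<close>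
  decreases by a multiple of its last three terms, up to an error of order
  \<open>(\<beta>\<^sub>k\<^sub>+\<^sub>1 + \<bar>\<lambda>\<^sub>k\<^sub>+\<^sub>1 - \<lambda>\<^sub>k\<bar>) (1 + E\<^sub>k)\<close>. Hence \<open>E\<^sub>k\<close> converges, the last three terms vanish,
  and \<open>\<parallel>x\<^sub>k - z\<parallel>\<close> converges for every \<open>z \<in> S\<close>. Opial's argument concludes; weak compactness
  is replaced by the nonempty intersection of the closed convex hulls of the tails of \<open>x\<close>, all of
  whose points lie in \<open>S\<close> by Minty's lemma.\<close>

section \<open>Hilbert space geometry: nested convex sets and projections\<close>

lemma parallelogram_midpoint:
  fixes p q :: "'a::real_inner"
  shows "(norm (p - q))\<^sup>2 = 2 * (norm p)\<^sup>2 + 2 * (norm q)\<^sup>2 - 4 * (norm (midpoint p q))\<^sup>2"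
  by (simp add: midpoint_def power2_norm_eq_inner inner_simps inner_commute field_simps)

text \<open>Points \<open>p n\<close> of almost minimal norm in \<open>K n\<close> form a Cauchy
  sequence. The midpoint of two late ones still lies in \<open>K N\<close>, so its norm is at least
  \<open>\<delta> N\<close>, and the parallelogram law bounds their distance by a gap that closes
  because \<open>\<delta>\<close> is increasing and, by boundedness of \<open>K 0\<close>,
  convergent.\<close>

lemma nested_closed_convex_Inter_nonempty:
  fixes K :: "nat \<Rightarrow> 'a::{real_inner, complete_space} set"
  assumes ne: "\<And>n. K n \<noteq> {}" and cl: "\<And>n. closed (K n)" and cv: "\<And>n. convex (K n)"
    and dec: "decseq K" and bd: "bounded (K 0)"
  obtains q where "\<And>n. q \<in> K n"
proof -
  define \<delta> where "\<delta> n = infdist 0 (K n)" for n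
  have sub: "K m \<subseteq> K n" if "n \<le> m" for m n
    using dec that by (simp add: decseq_def)
  have \<delta>_le: "\<delta> n \<le> norm p" if "p \<in> K n" for n p
    using infdist_le[OF that, of 0] by (simp add: \<delta>_def)
  have \<delta>_mono: "incseq \<delta>"
    unfolding incseq_def \<delta>_def using sub ne by (blast intro: infdist_mono)
  obtain M where M: "norm p \<le> M" if "p \<in> K 0" for p
    using bd by (auto simp: bounded_iff)
  have "\<delta> n \<le> M" for n
  proof -
    obtain p where "p \<in> K n" using ne by blast
    then show ?thesis using \<delta>_le[of p n] M[of p] sub[of 0 n] by force
  qed
  then obtain d where d: "\<delta> \<longlonglongrightarrow> d"
    using \<delta>_mono incseq_convergent by (metis)
  have \<delta>_le_d: "\<delta> n \<le> d" for n using incseq_le[OF \<delta>_mono d] .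
  have d0: "0 \<le> \<delta> n" for n by (simp add: \<delta>_def infdist_nonneg)
  have "\<exists>p\<in>K n. norm p < \<delta> n + 1 / real (Suc n)" for n
  proof -
    have "(INF a\<in>K n. dist 0 a) < \<delta> n + 1 / real (Suc n)"
      using ne by (simp add: \<delta>_def infdist_def)
    then show ?thesis
      using ne[of n] by (subst (asm) cInf_less_iff) (auto intro: bdd_belowI2[of _ 0])
  qed
  then obtain p where pK: "\<And>n. p n \<in> K n" and pn: "\<And>n. norm (p n) < \<delta> n + 1 / real (Suc n)"
    by metis
  have upper: "(norm (p n))\<^sup>2 \<le> (d + 1 / real (Suc N))\<^sup>2" if "N \<le> n" for n N
  proof -
    have "norm (p n) \<le> d + 1 / real (Suc n)" using pn[of n] \<delta>_le_d[of n] by simp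
    also have "\<dots> \<le> d + 1 / real (Suc N)" using that by (simp add: frac_le)
    finally show ?thesis by (intro power_mono) auto
  qed
  have dist_le: "(norm (p m - p n))\<^sup>2 \<le> 4 * (d + 1 / real (Suc N))\<^sup>2 - 4 * (\<delta> N)\<^sup>2"
    if "N \<le> m" "N \<le> n" for m n N
  proof -
    have "midpoint (p m) (p n) \<in> K N"
      using cv[of N] pK sub that by (metis convex_contains_segment midpoint_in_closed_segment subsetD)
    then have "(\<delta> N)\<^sup>2 \<le> (norm (midpoint (p m) (p n)))\<^sup>2"
      using \<delta>_le d0 by (intro power_mono) auto
    then show ?thesis
      using upper[OF that(1)] upper[OF that(2)] unfolding parallelogram_midpoint by linarith
  qed
  have "(\<lambda>N. 4 * (d + 1 / real (Suc N))\<^sup>2 - 4 * (\<delta> N)\<^sup>2) \<longlonglongrightarrow> 4 * (d + 0)\<^sup>2 - 4 * d\<^sup>2"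
    using LIMSEQ_Suc[OF lim_1_over_n] by (intro tendsto_intros d) auto
  then have lim0: "(\<lambda>N. 4 * (d + 1 / real (Suc N))\<^sup>2 - 4 * (\<delta> N)\<^sup>2) \<longlonglongrightarrow> 0" by simp
  have "Cauchy p"
  proof (rule metric_CauchyI)
    fix e :: real assume e: "0 < e"
    then have "\<forall>\<^sub>F N in sequentially. 4 * (d + 1 / real (Suc N))\<^sup>2 - 4 * (\<delta> N)\<^sup>2 < e\<^sup>2"
      by (intro order_tendstoD(2)[OF lim0]) auto
    then obtain N where N: "4 * (d + 1 / real (Suc N))\<^sup>2 - 4 * (\<delta> N)\<^sup>2 < e\<^sup>2"
      by (auto simp: eventually_sequentially)
    have "dist (p m) (p n) < e" if "N \<le> m" "N \<le> n" for m n
      using dist_le[OF that] N e unfolding dist_norm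
      by (meson le_less_trans less_imp_le power_less_imp_less_base)
    then show "\<exists>N. \<forall>m\<ge>N. \<forall>n\<ge>N. dist (p m) (p n) < e" by blast
  qed
  then obtain q where q: "p \<longlonglongrightarrow> q" using Cauchy_convergent convergent_def by blast
  have "q \<in> K n" for n
    using cl[of n]
  proof (rule closed_sequentially)
    show "p (i + n) \<in> K n" for i using pK sub[of n "i + n"] by auto
    show "(\<lambda>i. p (i + n)) \<longlonglongrightarrow> q" using q by (rule LIMSEQ_ignore_initial_segment)
  qed
  then show ?thesis by (rule that)
qed

text \<open>A nearest point is found without compactness, as a common point of the slices of
  \<open>C\<close> by closed balls whose radii shrink to the distance from \<open>x\<close>.
  Uniqueness makes the \<open>THE\<close> in \<open>metric_proj\<close> denote it.\<close>

lemma metric_proj_props: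
  fixes C :: "'a::{real_inner, complete_space} set"
  assumes "closed C" "convex C" "C \<noteq> {}"
  shows metric_proj_in: "metric_proj C x \<in> C"
    and metric_proj_dot: "\<And>y. y \<in> C \<Longrightarrow> inner (metric_proj C x - x) (y - metric_proj C x) \<ge> 0"
proof -
  define K where "K n = C \<inter> cball x (infdist x C + 1 / real (Suc n))" for n
  have "K n \<noteq> {}" for n
  proof -
    have "(INF a\<in>C. dist x a) < infdist x C + 1 / real (Suc n)"
      using assms(3) by (simp add: infdist_def)
    then show ?thesis
      using assms(3) by (subst (asm) cInf_less_iff) (auto simp: K_def intro: less_imp_le)
  qed
  moreover have "closed (K n)" "convex (K n)" for n
    using assms by (auto simp: K_def intro: convex_Int)
  moreover have "decseq K"
    unfolding K_def by (intro decseq_SucI Int_mono subset_cball) (auto intro: frac_le)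
  moreover have "bounded (K 0)" by (simp add: K_def bounded_Int)
  ultimately obtain q where q: "\<And>n. q \<in> K n" using nested_closed_convex_Inter_nonempty by metis
  have "(\<lambda>n. infdist x C + 1 / real (Suc n)) \<longlonglongrightarrow> infdist x C + 0"
    using LIMSEQ_Suc[OF lim_1_over_n] by (intro tendsto_intros) auto
  then have "dist x q \<le> infdist x C + 0"
    by (rule LIMSEQ_le_const) (use q in \<open>auto simp: K_def\<close>)
  then have min: "q \<in> C" "\<forall>y\<in>C. dist x q \<le> dist x y"
    using q[of 0] infdist_le[of _ C x] by (auto simp: K_def intro: order_trans)
  then have "metric_proj C x = q"
    unfolding metric_proj_def
    by (intro the_equality) (auto intro: any_closest_point_unique[OF assms(2,1)])
  then show "metric_proj C x \<in> C" "\<And>y. y \<in> C \<Longrightarrow> inner (metric_proj C x - x) (y - metric_proj C x) \<ge> 0"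
    using min any_closest_point_dot[OF assms(2,1) min(1) _ min(2)]
    by (auto simp: inner_diff_left)
qed

section \<open>Weak cluster points and Opial's argument\<close>

text \<open>The index set \<open>I\<close> selects a subsequence, and \<open>q\<close> stands in for
  one of its weak cluster points. Opial's argument takes \<open>I\<close> to be all indices, and
  later the indices at which a functional stays too large.\<close>

lemma closed_convex_hull_cluster_point:
  fixes x :: "nat \<Rightarrow> 'a::{real_inner, complete_space}"
  assumes "bounded (range x)" "infinite I"
  obtains q where "\<And>n. q \<in> closure (convex hull (x ` (I \<inter> {n..})))"
proof (rule nested_closed_convex_Inter_nonempty)
  show "closure (convex hull (x ` (I \<inter> {n..}))) \<noteq> {}" for n
    using assms(2) by (auto simp: infinite_nat_iff_unbounded_le)
  show "decseq (\<lambda>n. closure (convex hull (x ` (I \<inter> {n..}))))"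
    by (rule decseq_SucI) (intro closure_mono hull_mono image_mono, auto)
  show "bounded (closure (convex hull (x ` (I \<inter> {0..}))))"
    using assms(1) by (intro bounded_closure bounded_convex_hull) (auto intro: bounded_subset)
qed (use that in \<open>auto intro: convex_closure\<close>)

lemma closure_convex_hull_subset:
  assumes "closed T" "convex T" "\<And>k. k \<in> J \<Longrightarrow> x k \<in> T"
  shows "closure (convex hull (x ` J)) \<subseteq> T"
  using assms by (intro closure_minimal hull_minimal) auto

text \<open>The set \<open>Q\<close> of common points of the tail hulls is nonempty, lies in
  \<open>S\<close>, and has at most one element. A functional failing to converge to its value there
  would produce a second one.\<close>

lemma weak_convergence_Opial:
  fixes x :: "nat \<Rightarrow> 'a::{real_inner, complete_space}"
  assumes bd: "bounded (range x)"
    and conv: "\<And>p. p \<in> S \<Longrightarrow> convergent (\<lambda>k. (norm (x k - p))\<^sup>2)"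
    and cluster: "\<And>q. (\<And>n. q \<in> closure (convex hull (x ` {n..}))) \<Longrightarrow> q \<in> S"
  shows "\<exists>p\<in>S. converges_weakly x p"
proof -
  define Q where "Q = {q. \<forall>n. q \<in> closure (convex hull (x ` {n..}))}"
  have half_space: "f q \<le> c"
    if f: "bounded_linear f" and ev: "\<forall>\<^sub>F k in sequentially. f (x k) \<le> c" and q: "q \<in> Q"
    for f :: "'a \<Rightarrow> real" and c q
  proof -
    obtain n where "\<And>k. k \<ge> n \<Longrightarrow> f (x k) \<le> c"
      using ev by (auto simp: eventually_sequentially)
    moreover have "closed {w. f w \<le> c}"
      using f by (intro closed_Collect_le linear_continuous_on continuous_on_const)
    moreover have "convex {w. f w \<le> c}"
      using convex_linear_vimage[of f "{..c}"] f
      by (simp add: vimage_def bounded_linear.linear)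
    ultimately have "closure (convex hull (x ` {n..})) \<subseteq> {w. f w \<le> c}"
      by (intro closure_convex_hull_subset) auto
    with q show ?thesis by (auto simp: Q_def)
  qed
  \<comment> \<open>A functional that converges along \<open>x\<close> is constant on
    \<open>Q\<close>, since a closed half-space containing a tail contains \<open>Q\<close>.\<close>
  have limit: "f q = l"
    if f: "bounded_linear f" and l: "(\<lambda>k. f (x k)) \<longlonglongrightarrow> l" and q: "q \<in> Q"
    for f :: "'a \<Rightarrow> real" and l q
  proof (rule antisym)
    show "f q \<le> l"
    proof (rule field_le_epsilon)
      fix e :: real assume "0 < e"
      then have "\<forall>\<^sub>F k in sequentially. f (x k) < l + e" by (intro order_tendstoD(2)[OF l]) simp
      then show "f q \<le> l + e" by (intro half_space[OF f _ q]) (auto elim: eventually_mono)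
    qed
    have "- f q \<le> - l"
    proof (rule field_le_epsilon)
      fix e :: real assume "0 < e"
      then have "\<forall>\<^sub>F k in sequentially. l - e < f (x k)" by (intro order_tendstoD(1)[OF l]) simp
      then show "- f q \<le> - l + e"
        by (intro half_space[OF bounded_linear_minus[OF f] _ q]) (auto elim: eventually_mono)
    qed
    then show "l \<le> f q" by simp
  qed
  have QS: "Q \<subseteq> S" using cluster by (auto simp: Q_def)
  have unique: "p = q" if "p \<in> Q" "q \<in> Q" for p q
  proof -
    \<comment> \<open>In the difference of the two squared distances the norm of \<open>x k\<close>
      cancels, so the inner product with \<open>p - q\<close> converges along \<open>x\<close> and
      must agree at \<open>p\<close> and \<open>q\<close>.\<close>
    have "inner (x k) (p - q) = ((norm (x k - q))\<^sup>2 - (norm (x k - p))\<^sup>2 + (norm p)\<^sup>2 - (norm q)\<^sup>2) / 2"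
      for k unfolding power2_norm_eq_inner by (simp add: inner_simps inner_commute)
    moreover obtain a where "(\<lambda>k. (norm (x k - q))\<^sup>2) \<longlonglongrightarrow> a"
      using conv[of q] subsetD[OF QS \<open>q \<in> Q\<close>] by (auto simp: convergent_def)
    moreover obtain b where "(\<lambda>k. (norm (x k - p))\<^sup>2) \<longlonglongrightarrow> b"
      using conv[of p] subsetD[OF QS \<open>p \<in> Q\<close>] by (auto simp: convergent_def)
    ultimately have "(\<lambda>k. inner (x k) (p - q)) \<longlonglongrightarrow> (a - b + (norm p)\<^sup>2 - (norm q)\<^sup>2) / 2"
      by (simp only:) (intro tendsto_intros, auto)
    then have "inner p (p - q) = inner q (p - q)"
      using limit[OF bounded_linear_inner_left] that by metis
    then have "inner (p - q) (p - q) = 0" by (simp add: inner_diff_left)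
    then show ?thesis by simp
  qed
  obtain p where p: "p \<in> Q"
    using closed_convex_hull_cluster_point[OF bd, of UNIV] by (auto simp: Q_def)
  \<comment> \<open>The upper bound suffices, since applied to \<open>- f\<close> it gives the lower
    one. If it failed, the offending indices would yield a point of \<open>Q\<close>, hence
    \<open>p\<close> itself, at which \<open>f\<close> is at least \<open>f p + e\<close>.\<close>
  have upper: "\<forall>\<^sub>F k in sequentially. f (x k) < f p + e"
    if f: "bounded_linear f" and e: "0 < e" for f :: "'a \<Rightarrow> real" and e
  proof (rule ccontr)
    assume "\<not> ?thesis"
    then have "infinite {k. f p + e \<le> f (x k)}"
      by (simp add: not_eventually frequently_cofinite flip: cofinite_eq_sequentially not_less)
    then obtain q where q: "\<And>n. q \<in> closure (convex hull (x ` ({k. f p + e \<le> f (x k)} \<inter> {n..})))"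
      using closed_convex_hull_cluster_point[OF bd] by metis
    have "q \<in> closure (convex hull (x ` {n..}))" for n
      using q[of n] by (meson closure_mono hull_mono image_mono inf_le2 subsetD)
    then have "q = p" using unique p by (simp add: Q_def)
    moreover have "closed {w. f p + e \<le> f w}"
      using f by (intro closed_Collect_le linear_continuous_on continuous_on_const)
    moreover have "convex {w. f p + e \<le> f w}"
      using convex_linear_vimage[of f "{f p + e..}"] f
      by (simp add: vimage_def bounded_linear.linear)
    ultimately have "p \<in> {w. f p + e \<le> f w}"
      using q[of 0] closure_convex_hull_subset[of "{w. f p + e \<le> f w}" "{k. f p + e \<le> f (x k)} \<inter> {0..}" x]
      by auto
    with e show False by simp
  qed
  have "converges_weakly x p"
    unfolding converges_weakly_def
  proof (intro allI impI)
    fix f :: "'a \<Rightarrow> real" assume f: "bounded_linear f"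
    show "(\<lambda>k. f (x k)) \<longlonglongrightarrow> f p"
    proof (rule order_tendstoI)
      fix a assume "a < f p"
      then show "\<forall>\<^sub>F k in sequentially. a < f (x k)"
        using upper[OF bounded_linear_minus[OF f], of "f p - a"] by simp
    next
      fix a assume "f p < a"
      then show "\<forall>\<^sub>F k in sequentially. f (x k) < a"
        using upper[OF f, of "a - f p"] by simp
    qed
  qed
  then show ?thesis using p QS by blast
qed

section \<open>Perturbed monotone sequences and Minty's lemma\<close>

lemma quasi_Fejer:
  fixes E D \<delta> :: "nat \<Rightarrow> real"
  assumes E: "\<And>k. 0 \<le> E k" and D: "\<And>k. 0 \<le> D k" and \<delta>: "\<And>k. 0 \<le> \<delta> k" and sm: "summable \<delta>"
    and step: "\<And>k. E (Suc k) + D k \<le> E k + \<delta> k * (1 + E k)"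
  shows "convergent E" "D \<longlonglongrightarrow> 0"
proof -
  \<comment> \<open>dividing \<open>1 + E\<close> by the partial products of \<open>1 + \<delta>\<close> makes it monotone\<close>
  define P where "P n = (\<Prod>i<n. 1 + \<delta> i)" for n
  have P1: "1 \<le> P n" for n unfolding P_def using \<delta> by (intro prod_ge_1) auto
  have P_le: "P n \<le> exp (suminf \<delta>)" for n
  proof -
    have "P n \<le> (\<Prod>i<n. exp (\<delta> i))"
      unfolding P_def using \<delta> by (intro prod_mono) (auto intro: add_nonneg_nonneg)
    also have "\<dots> = exp (\<Sum>i<n. \<delta> i)" by (simp add: exp_sum)
    also have "\<dots> \<le> exp (suminf \<delta>)" using sm \<delta> by (simp add: sum_le_suminf)
    finally show ?thesis .
  qed
  have PSuc: "P (Suc n) = P n * (1 + \<delta> n)" for n by (simp add: P_def)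
  have "P n * 1 \<le> P n * (1 + \<delta> n)" for n
    using P1[of n] \<delta>[of n] by (intro mult_left_mono) auto
  then have "incseq P" by (intro incseq_SucI) (simp add: PSuc)
  then obtain p where p: "P \<longlonglongrightarrow> p" using P_le incseq_convergent by metis
  define G where "G n = (1 + E n) / P n" for n
  \<comment> \<open>Keeping \<open>D n\<close> here gives more than monotonicity of
    \<open>G\<close>: as \<open>G\<close> and \<open>P\<close> converge, the decrement times
    \<open>P (Suc n)\<close> tends to 0 and squeezes \<open>D\<close>.\<close>
  have G: "D n / P (Suc n) \<le> G n - G (Suc n)" for n
  proof -
    have "(1 + E (Suc n)) + D n \<le> (1 + E n) * (1 + \<delta> n)" using step[of n] by (simp add: algebra_simps)
    then have "((1 + E (Suc n)) + D n) / P (Suc n) \<le> (1 + E n) * (1 + \<delta> n) / P (Suc n)"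
      using P1[of "Suc n"] by (intro divide_right_mono) auto
    also have "\<dots> = G n" using \<delta>[of n] by (simp add: G_def PSuc)
    finally show ?thesis by (simp add: G_def add_divide_distrib)
  qed
  have Dnn: "0 \<le> D n / P (Suc n)" for n using D[of n] P1[of "Suc n"] by simp
  have "decseq G" using G Dnn by (intro decseq_SucI) (smt (verit))
  moreover have "0 \<le> G n" for n using E[of n] P1[of n] by (simp add: G_def)
  ultimately obtain g where g: "G \<longlonglongrightarrow> g" using decseq_convergent by metis
  have "P n \<noteq> 0" for n using P1[of n] by auto
  then have "E = (\<lambda>n. G n * P n - 1)" by (simp add: G_def)
  moreover have "(\<lambda>n. G n * P n - 1) \<longlonglongrightarrow> g * p - 1" by (intro tendsto_intros g p)
  ultimately show "convergent E" by (auto simp: convergent_def)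
  have "(\<lambda>n. (G n - G (Suc n)) * P (Suc n)) \<longlonglongrightarrow> (g - g) * p"
    by (intro tendsto_intros g p LIMSEQ_Suc)
  moreover have "D n \<le> (G n - G (Suc n)) * P (Suc n)" for n
    using G[of n] P1[of "Suc n"] by (simp add: pos_divide_le_eq)
  ultimately show "D \<longlonglongrightarrow> 0"
    using D by (intro tendsto_sandwich[of "\<lambda>_. 0" D sequentially]) auto
qed

text \<open>The hypothesis is tested on the segment from \<open>q\<close> towards \<open>w\<close>;
  the positive step length cancels, and continuity of \<open>B\<close> moves the operator value back
  to \<open>q\<close>.\<close>

lemma Minty_VI:
  fixes B :: "'a::real_inner \<Rightarrow> 'a"
  assumes "convex C" and cont: "continuous_on UNIV B" and q: "q \<in> C"
    and minty: "\<And>y. y \<in> C \<Longrightarrow> 0 \<le> inner (B y) (y - q)"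
  shows "q \<in> VI_solutions B C"
proof -
  have "0 \<le> inner (B q) (w - q)" if w: "w \<in> C" for w
  proof -
    define y where "y n = q + (1 / real (Suc n)) *\<^sub>R (w - q)" for n
    have "y n \<in> C" for n
      using convexD_alt[OF \<open>convex C\<close> q w, of "1 / real (Suc n)"] by (simp add: y_def algebra_simps)
    then have nonneg: "0 \<le> inner (B (y n)) (w - q)" for n
      using minty[of "y n"] by (simp add: y_def zero_le_divide_iff)
    have "y \<longlonglongrightarrow> q + 0 *\<^sub>R (w - q)"
      unfolding y_def using LIMSEQ_Suc[OF lim_1_over_n] by (intro tendsto_intros) auto
    then have "(\<lambda>n. B (y n)) \<longlonglongrightarrow> B q"
      using continuous_on_tendsto_compose[OF cont] by simp
    then have "(\<lambda>n. inner (B (y n)) (w - q)) \<longlonglongrightarrow> inner (B q) (w - q)"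
      by (intro tendsto_intros)
    then show ?thesis using nonneg by (intro LIMSEQ_le_const) auto
  qed
  with q show ?thesis by (simp add: VI_solutions_def)
qed

section \<open>Estimates for one iteration\<close>

text \<open>\<open>N\<close> is the scale against which errors are measured: these bounds make
  products with the perturbation \<open>b *\<^sub>R (x0 - u0)\<close> of order
  \<open>b * N\<^sup>2\<close>. \<open>F1\<close> and \<open>G\<close> stand for the values of
  \<open>B\<close> at \<open>u1\<close> and \<open>z\<close>.\<close>

lemma iteration_energy_bounds:
  fixes z x0 x1 x2 u0 u1 F1 G :: "'a::real_inner" and L l1 b N :: real
  defines "N \<equiv> 1 + norm (x1 - z) + norm (x1 - x0) + norm (x1 - u0)"
  assumes L: "0 < L" and l1: "0 < l1" "l1 * L \<le> 1 / 5" and b: "0 \<le> b" "b \<le> 1 / 4"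
    and u1: "u1 = 2 *\<^sub>R x1 - x0 + b *\<^sub>R (x0 - u0)"
    and lip1: "norm (F1 - G) \<le> L * norm (u1 - z)"
    and proj2: "0 \<le> inner (x2 - x1 + l1 *\<^sub>R F1) (z - x2)"
    and G2: "0 \<le> inner G (x2 - z)"
  shows "norm (x0 - u0) \<le> N" and "norm (x2 - u1) \<le> 5 * N"
proof -
  have "norm (x0 - u0) \<le> norm (x1 - u0) + norm (x1 - x0)"
    using norm_triangle_ineq4[of "x1 - u0" "x1 - x0"] by simp
  then show v: "norm (x0 - u0) \<le> N" using norm_ge_zero[of "x1 - z"] unfolding N_def by linarith
  have N1: "1 \<le> N" by (simp add: N_def)
  have "u1 - z = (x1 - z) + (x1 - x0) + b *\<^sub>R (x0 - u0)"
    by (simp add: u1 scaleR_2)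
  then have "norm (u1 - z) \<le> norm (x1 - z) + norm (x1 - x0) + b * norm (x0 - u0)"
    using b by (metis norm_triangle_le norm_triangle_ineq add_mono order_refl norm_scaleR abs_of_nonneg)
  moreover have "b * norm (x0 - u0) \<le> 1 * N" using b v N1 by (intro mult_mono) auto
  moreover have "norm (x1 - z) + norm (x1 - x0) \<le> N" by (simp add: N_def)
  ultimately have u1z: "norm (u1 - z) \<le> 2 * N" by linarith
  \<comment> \<open>The last two terms subtract nonnegative quantities, so \<open>x2\<close> is no
    farther from \<open>z\<close> than a forward step from \<open>x1\<close> along
    \<open>F1 - G\<close>.\<close>
  have "(norm (x2 - z))\<^sup>2 = inner (x1 - z - l1 *\<^sub>R (F1 - G)) (x2 - z)
      - inner (x2 - x1 + l1 *\<^sub>R F1) (z - x2) - l1 * inner G (x2 - z)"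
    unfolding power2_norm_eq_inner by (simp add: inner_simps inner_commute algebra_simps)
  also have "\<dots> \<le> inner (x1 - z - l1 *\<^sub>R (F1 - G)) (x2 - z)"
    using proj2 mult_nonneg_nonneg[OF less_imp_le[OF l1(1)] G2] by linarith
  also have "\<dots> \<le> norm (x1 - z - l1 *\<^sub>R (F1 - G)) * norm (x2 - z)" by (rule norm_cauchy_schwarz)
  finally have "norm (x2 - z) \<le> norm (x1 - z - l1 *\<^sub>R (F1 - G))"
    by (cases "norm (x2 - z) = 0") (auto simp: power2_eq_square)
  also have "\<dots> \<le> norm (x1 - z) + l1 * norm (F1 - G)"
    using norm_triangle_ineq4[of "x1 - z" "l1 *\<^sub>R (F1 - G)"] l1 by simp
  also have "l1 * norm (F1 - G) \<le> (l1 * L) * norm (u1 - z)"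
    using lip1 l1 by (simp add: mult.assoc)
  also have "\<dots> \<le> (1 / 5) * (2 * N)" using l1 u1z L by (intro mult_mono) auto
  finally have "norm (x2 - z) \<le> 2 * N"
    using N1 \<open>norm (x1 - z) + norm (x1 - x0) \<le> N\<close> norm_ge_zero[of "x1 - x0"] by linarith
  then show "norm (x2 - u1) \<le> 5 * N"
    using norm_triangle_ineq4[of "x2 - z" "u1 - z"] u1z N1 by simp
qed

text \<open>\<open>F0\<close>, \<open>F1\<close>, \<open>G\<close> stand for the values of
  \<open>B\<close> at \<open>u0\<close>, \<open>u1\<close>, \<open>z\<close>. The reflected point
  \<open>2 *\<^sub>R x1 - x0\<close> need not lie in \<open>C\<close>, so the projection inequality
  at \<open>x1\<close> is tested with both \<open>x0\<close> and \<open>x2\<close>; the sum controls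
  the direction from the reflected point to \<open>x2\<close>.\<close>

lemma iteration_energy_step:
  fixes z x0 x1 x2 u0 u1 F0 F1 G :: "'a::real_inner" and L l0 l1 b g :: real
  defines "N \<equiv> 1 + norm (x1 - z) + norm (x1 - x0) + norm (x1 - u0)"
  assumes L: "0 < L" and l0: "0 < l0" "l0 * L \<le> 1 / 5" and l1: "0 < l1" "l1 * L \<le> 1 / 5"
    and b: "0 \<le> b" "b \<le> 1 / 4"
    and u1: "u1 = 2 *\<^sub>R x1 - x0 + b *\<^sub>R (x0 - u0)"
    and lip01: "norm (F1 - F0) \<le> L * norm (u1 - u0)"
    and lip0: "norm (F0 - G) \<le> L * norm (u0 - z)"
    and lip1: "norm (F1 - G) \<le> L * norm (u1 - z)"
    and mono: "0 \<le> inner (F1 - G) (u1 - z)"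
    and proj10: "0 \<le> inner (x1 - x0 + l0 *\<^sub>R F0) (x0 - x1)"
    and proj12: "0 \<le> inner (x1 - x0 + l0 *\<^sub>R F0) (x2 - x1)"
    and proj2: "0 \<le> inner (x2 - x1 + l1 *\<^sub>R F1) (z - x2)"
    and G: "0 \<le> inner G (x0 - z)" "0 \<le> inner G (x2 - z)"
    and g: "norm G \<le> g"
  shows "(norm (x2 - z))\<^sup>2 + 2/5 * (norm (x2 - u1))\<^sup>2 + 1/10 * (norm (x2 - x1))\<^sup>2 + 4 * (l1 * inner G (x1 - z))
    \<le> (norm (x1 - z))\<^sup>2 + 1/5 * (norm (x1 - u0))\<^sup>2 - 3/5 * (norm (x1 - x0))\<^sup>2 + 2 * (l0 * inner G (x0 - z))
      + (b + \<bar>l1 - l0\<bar>) * ((12 * (g + L) + (g + L) / L + 14) * N\<^sup>2)"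
proof -
  define d1 d2 s1 s2 v e where "d1 = x1 - x0" "d2 = x2 - x1" "s1 = x1 - u0" "s2 = x2 - u1"
    "v = x0 - u0" "e = b *\<^sub>R v"
  note defs = d1_d2_s1_s2_v_e_def
  have vN: "norm v \<le> N" and s2N: "norm s2 \<le> 5 * N"
    using iteration_energy_bounds[OF L l1 b u1 lip1 proj2 G(2)] by (simp_all add: defs N_def)
  have d1N: "norm d1 \<le> N" and s1N: "norm s1 \<le> N" and N1: "1 \<le> N" and zN: "norm (x1 - z) + norm s1 \<le> N"
     and x0N: "norm (x1 - z) + norm d1 \<le> N"
    by (simp_all add: defs N_def)
  have g0: "0 \<le> g" using g norm_ge_zero order_trans by blast
  have eN: "norm e \<le> b * N" using vN b by (simp add: defs mult_left_mono)
  have x0z: "norm (x0 - z) \<le> N"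
    using norm_triangle_ineq4[of "x1 - z" d1] x0N by (simp add: defs)
  have "norm (u0 - z) \<le> N"
    using norm_triangle_ineq4[of "x1 - z" s1] zN by (simp add: defs)
  then have "norm (F0 - G) \<le> L * N" using lip0 L by (meson less_imp_le mult_left_mono order_trans)
  then have "norm F0 \<le> g + L * N" using norm_triangle_ineq[of "F0 - G" G] g by simp
  moreover have "g * 1 \<le> g * N" using g0 N1 by (intro mult_left_mono)
  ultimately have F0N: "norm F0 \<le> (g + L) * N" by (simp add: algebra_simps)
  \<comment> \<open>\<open>s2 + e\<close> is the displacement from the exact reflection
    \<open>2 *\<^sub>R x1 - x0\<close> to \<open>x2\<close>, so \<open>e\<close> carries the whole
    perturbation.\<close>
  have d2: "d2 = s2 + d1 + e" and u10: "u1 - u0 = d1 + e + s1" and u1z: "u1 - z = 2 *\<^sub>R (x1 - z) - (x0 - z) + e"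
    by (simp_all add: defs u1 scaleR_2)
  have T0: "(norm (x2 - z))\<^sup>2 \<le> (norm (x1 - z))\<^sup>2 - (norm d1)\<^sup>2 - (norm (s2 + e))\<^sup>2
      - 2 * (l1 * inner (F1 - F0) s2) - 2 * ((l1 - l0) * inner F0 s2) + 2 * (l0 * inner F0 e)
      - 2 * (l1 * inner G (u1 - z))"
  proof -
    \<comment> \<open>the gap is exactly the monotonicity inequality plus the three projection inequalities\<close>
    have "(norm (x1 - z))\<^sup>2 - (norm d1)\<^sup>2 - (norm (s2 + e))\<^sup>2
      - 2 * (l1 * inner (F1 - F0) s2) - 2 * ((l1 - l0) * inner F0 s2) + 2 * (l0 * inner F0 e)
      - 2 * (l1 * inner G (u1 - z)) - (norm (x2 - z))\<^sup>2
      = 2 * (l1 * inner (F1 - G) (u1 - z)) + 2 * inner (x1 - x0 + l0 *\<^sub>R F0) (x0 - x1)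
        + 2 * inner (x1 - x0 + l0 *\<^sub>R F0) (x2 - x1) + 2 * inner (x2 - x1 + l1 *\<^sub>R F1) (z - x2)"
      unfolding power2_norm_eq_inner defs u1 scaleR_2
      by (simp add: inner_simps inner_commute algebra_simps)
    also have "\<dots> \<ge> 0"
      using proj10 proj12 proj2 mult_nonneg_nonneg[OF less_imp_le[OF l1(1)] mono] by linarith
    finally show ?thesis by linarith
  qed
  \<comment> \<open>The bound \<open>l1 * L \<le> 1 / 5\<close> fixes the budget. Doubled as in
    \<open>T0\<close>, this estimate spends 2/5 of \<open>(norm s2)\<^sup>2\<close> and 1/5 of
    \<open>(norm d1)\<^sup>2\<close>; paying for \<open>1/10 * (norm d2)\<^sup>2\<close> through
    \<open>T7\<close> spends another 1/5 of each, leaving exactly the 2/5 and 3/5 of the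
    claim.\<close>
  have T1: "- (l1 * inner (F1 - F0) s2) \<le> 1/10 * (norm d1)\<^sup>2 + 1/10 * (norm s1)\<^sup>2 + 1/5 * (norm s2)\<^sup>2 + b * N\<^sup>2"
  proof -
    have "- (l1 * inner (F1 - F0) s2) \<le> l1 * (norm (F1 - F0) * norm s2)"
      using mult_left_mono[OF norm_cauchy_schwarz[of "- (F1 - F0)" s2], of l1] l1
      unfolding inner_minus_left norm_minus_cancel by simp
    also have "\<dots> \<le> l1 * (L * norm (u1 - u0) * norm s2)"
      using lip01 l1 by (intro mult_left_mono mult_right_mono) auto
    also have "\<dots> = (l1 * L) * (norm (u1 - u0) * norm s2)" by simp
    also have "\<dots> \<le> 1/5 * (norm (u1 - u0) * norm s2)" using l1 by (intro mult_right_mono) auto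
    also have "\<dots> \<le> 1/5 * ((norm d1 + norm e + norm s1) * norm s2)"
      unfolding u10 by (intro mult_left_mono mult_right_mono norm_triangle_mono) auto
    also have "\<dots> = 1/5 * (norm d1 * norm s2) + 1/5 * (norm s1 * norm s2) + 1/5 * (norm e * norm s2)"
      by (simp add: algebra_simps)
    also have "1/5 * (norm d1 * norm s2) \<le> 1/10 * (norm d1)\<^sup>2 + 1/10 * (norm s2)\<^sup>2"
      using sum_squares_bound[of "norm d1" "norm s2"] by simp
    also have "1/5 * (norm s1 * norm s2) \<le> 1/10 * (norm s1)\<^sup>2 + 1/10 * (norm s2)\<^sup>2"
      using sum_squares_bound[of "norm s1" "norm s2"] by simp
    also have "norm e * norm s2 \<le> (b * N) * (5 * N)"
      using eN s2N b N1 by (intro mult_mono) auto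
    finally show ?thesis by (simp add: power2_eq_square algebra_simps)
  qed
  have T2: "- ((l1 - l0) * inner F0 s2) \<le> \<bar>l1 - l0\<bar> * (5 * (g + L) * N\<^sup>2)"
  proof -
    have "- ((l1 - l0) * inner F0 s2) \<le> \<bar>l1 - l0\<bar> * \<bar>inner F0 s2\<bar>"
      by (simp flip: abs_mult)
    also have "\<dots> \<le> \<bar>l1 - l0\<bar> * (norm F0 * norm s2)"
      by (intro mult_left_mono Cauchy_Schwarz_ineq2) simp
    also have "\<dots> \<le> \<bar>l1 - l0\<bar> * (((g + L) * N) * (5 * N))"
      using F0N s2N by (intro mult_left_mono mult_mono) (auto intro: order_trans[OF norm_ge_zero])
    finally show ?thesis by (simp add: power2_eq_square algebra_simps)
  qed
  have T3: "l0 * inner F0 e \<le> b * ((g + L) / (5 * L) * N\<^sup>2)"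
  proof -
    have "l0 * inner F0 e \<le> l0 * (norm F0 * norm e)"
      using l0 by (intro mult_left_mono norm_cauchy_schwarz) auto
    also have "\<dots> \<le> (1 / (5 * L)) * (((g + L) * N) * (b * N))"
      using l0 L F0N eN by (intro mult_mono) (auto simp: field_simps intro: order_trans[OF norm_ge_zero])
    finally show ?thesis by (simp add: power2_eq_square ac_simps)
  qed
  have T4: "- (l1 * inner G e) \<le> b * ((g + L) / (5 * L) * N\<^sup>2)"
  proof -
    have "- (l1 * inner G e) \<le> l1 * (norm G * norm e)"
      using mult_left_mono[OF norm_cauchy_schwarz[of "-G" e], of l1] l1 by (simp add: inner_minus_left)
    also have "\<dots> \<le> (1 / (5 * L)) * (((g + L) * N) * (b * N))"
    proof (intro mult_mono)
      show "l1 \<le> 1 / (5 * L)" using l1 L by (simp add: field_simps)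
      have "g * 1 \<le> (g + L) * N" using g0 L N1 by (intro mult_mono) auto
      then show "norm G \<le> (g + L) * N" using g by simp
    qed (use eN l1 L g0 N1 in auto)
    finally show ?thesis by (simp add: power2_eq_square ac_simps)
  qed
  \<comment> \<open>Step sizes may move either way: as the inner product is nonnegative, the drift
    can be replaced by its absolute value.\<close>
  have T5: "(l1 - l0) * inner G (x0 - z) \<le> \<bar>l1 - l0\<bar> * (g * N\<^sup>2)"
  proof -
    have "(l1 - l0) * inner G (x0 - z) \<le> \<bar>l1 - l0\<bar> * inner G (x0 - z)"
      using G by (intro mult_right_mono) auto
    also have "\<dots> \<le> \<bar>l1 - l0\<bar> * (norm G * norm (x0 - z))"
      by (intro mult_left_mono norm_cauchy_schwarz) auto
    also have "\<dots> \<le> \<bar>l1 - l0\<bar> * (g * N)"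
      using g x0z by (intro mult_left_mono mult_mono) (auto intro: g0)
    also have "\<dots> \<le> \<bar>l1 - l0\<bar> * (g * N\<^sup>2)"
      using N1 g0 by (intro mult_left_mono) (auto simp: power2_eq_square)
    finally show ?thesis .
  qed
  have T6: "(norm (s2 + e))\<^sup>2 \<ge> (norm s2)\<^sup>2 - 10 * (b * N\<^sup>2)"
  proof -
    have "(norm (s2 + e))\<^sup>2 = (norm s2)\<^sup>2 + 2 * inner s2 e + (norm e)\<^sup>2"
      unfolding power2_norm_eq_inner by (simp add: inner_simps inner_commute)
    moreover have "\<bar>inner s2 e\<bar> \<le> (5 * N) * (b * N)"
      using Cauchy_Schwarz_ineq2[of s2 e] mult_mono[OF s2N eN] N1 by auto
    then have "\<bar>inner s2 e\<bar> \<le> 5 * (b * N\<^sup>2)" by (simp add: power2_eq_square ac_simps)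
    ultimately show ?thesis using zero_le_power2[of "norm e"] by linarith
  qed
  have T7: "(norm d2)\<^sup>2 \<le> 2 * (norm s2)\<^sup>2 + 2 * (norm d1)\<^sup>2 + 13 * (b * N\<^sup>2)"
  proof -
    have "(norm d2)\<^sup>2 = (norm (s2 + d1))\<^sup>2 + 2 * inner (s2 + d1) e + (norm e)\<^sup>2"
      unfolding d2 power2_norm_eq_inner by (simp add: inner_simps inner_commute)
    moreover have "(norm (s2 + d1))\<^sup>2 \<le> 2 * (norm s2)\<^sup>2 + 2 * (norm d1)\<^sup>2"
    proof -
      have "0 \<le> (norm (s2 - d1))\<^sup>2" by simp
      then show ?thesis unfolding power2_norm_eq_inner by (simp add: inner_simps inner_commute)
    qed
    moreover have "inner (s2 + d1) e \<le> 6 * (b * N\<^sup>2)"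
    proof -
      have "norm (s2 + d1) \<le> 6 * N" using norm_triangle_ineq[of s2 d1] s2N d1N by simp
      then have "norm (s2 + d1) * norm e \<le> (6 * N) * (b * N)" using eN N1 by (intro mult_mono) auto
      then show ?thesis using norm_cauchy_schwarz[of "s2 + d1" e] by (simp add: power2_eq_square ac_simps)
    qed
    moreover have "(norm e)\<^sup>2 \<le> b * N\<^sup>2"
    proof -
      have "norm e \<le> N" using eN b N1 mult_right_mono[of b 1 N] by linarith
      then have "norm e * norm e \<le> N * (b * N)" using eN N1 by (intro mult_mono) auto
      then show ?thesis by (simp add: power2_eq_square ac_simps)
    qed
    ultimately show ?thesis by linarith
  qed
  \<comment> \<open>Up to errors, reflection turns the \<open>G\<close> term into twice its new
    value minus its old one. After doubling, half of the new part enters the next energy and half is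
    a decrease.\<close>
  have G1: "l1 * inner G (u1 - z) = 2 * (l1 * inner G (x1 - z)) - l0 * inner G (x0 - z)
      - (l1 - l0) * inner G (x0 - z) + l1 * inner G e"
    unfolding u1z by (simp add: inner_simps algebra_simps)
  have K: "b * ((g + L) / (5 * L) * N\<^sup>2) = 1/5 * (b * ((g + L) / L * N\<^sup>2))" by simp
  have nn: "0 \<le> b * ((g + L) * N\<^sup>2)" "0 \<le> b * ((g + L) / L * N\<^sup>2)" "0 \<le> b * N\<^sup>2"
    "0 \<le> \<bar>l1 - l0\<bar> * ((g + L) / L * N\<^sup>2)" "0 \<le> \<bar>l1 - l0\<bar> * N\<^sup>2" "0 \<le> \<bar>l1 - l0\<bar> * (L * N\<^sup>2)"
    using b g0 L by simp_all
  \<comment> \<open>With the factors from \<open>T0\<close>, \<open>T2\<close> and \<open>T5\<close>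
    cost 10 + 2 = 12 copies of the \<open>g\<close> term, \<open>T3\<close> and \<open>T4\<close>
    cost 4/5 of a copy of the \<open>(g + L) / L\<close> term, and \<open>T1\<close>,
    \<open>T6\<close>, \<open>T7\<close> cost 2 + 10 + 1.3 < 14 copies of
    \<open>b * N\<^sup>2\<close>.\<close>
  have split: "(b + \<bar>l1 - l0\<bar>) * ((12 * (g + L) + (g + L) / L + 14) * N\<^sup>2)
    = 12 * (b * ((g + L) * N\<^sup>2)) + b * ((g + L) / L * N\<^sup>2) + 14 * (b * N\<^sup>2)
      + 12 * (\<bar>l1 - l0\<bar> * (g * N\<^sup>2)) + 12 * (\<bar>l1 - l0\<bar> * (L * N\<^sup>2))
      + \<bar>l1 - l0\<bar> * ((g + L) / L * N\<^sup>2) + 14 * (\<bar>l1 - l0\<bar> * N\<^sup>2)"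
    by (simp add: distrib_left distrib_right add_divide_distrib)
  have T2': "- ((l1 - l0) * inner F0 s2) \<le> 5 * (\<bar>l1 - l0\<bar> * (g * N\<^sup>2)) + 5 * (\<bar>l1 - l0\<bar> * (L * N\<^sup>2))"
    using T2 by (simp add: algebra_simps)
  \<comment> \<open>stated for opaque reals, since linear arithmetic would otherwise split the absolute values\<close>
  have combine: "X2 + 2/5 * S2 + 1/10 * D2 + 4 * R1 \<le> X1 + 1/5 * S1 - 3/5 * D1 + 2 * R0
      + (12 * c1 + c2 + 14 * c3 + 12 * c4 + 12 * c5 + c6 + 14 * c7)"
    if "X2 \<le> X1 - D1 - SE - 2 * t1 - 2 * t2 + 2 * t3 - 2 * RU"
      "- t1 \<le> 1/10 * D1 + 1/10 * S1 + 1/5 * S2 + c3" "- t2 \<le> 5 * c4 + 5 * c5"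
      "t3 \<le> 1/5 * c2" "- t4 \<le> 1/5 * c2" "t5 \<le> c4" "SE \<ge> S2 - 10 * c3"
      "D2 \<le> 2 * S2 + 2 * D1 + 13 * c3" "RU = 2 * R1 - R0 - t5 + t4"
      "0 \<le> c1" "0 \<le> c2" "0 \<le> c3" "0 \<le> c6" "0 \<le> c7" "0 \<le> c5"
    for X1 X2 S1 S2 D1 D2 R0 R1 c1 c2 c3 c4 c5 c6 c7 t1 t2 t3 t4 t5 SE RU :: real
    using that by linarith
  show ?thesis
    unfolding split
    using combine[OF T0 T1 T2' T3[unfolded K] T4[unfolded K] T5 T6 T7 G1 nn] unfolding defs .
qed

section \<open>Convergence of the iteration\<close>

theorem theorem6p1:
  fixes C :: "'a::{real_inner, complete_space} set"
    and B :: "'a \<Rightarrow> 'a"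
    and L lam_min :: real
    and lam \<beta> \<theta> :: "nat \<Rightarrow> real"
    and x u :: "nat \<Rightarrow> 'a"
  assumes "C \<noteq> {}" and "closed C" and "convex C"
    and "monotone_operator B"
    and "L > 0" and "L-lipschitz_on UNIV B"
    and "VI_solutions B C \<noteq> {}"
    and "0 < lam 0" and "lam 0 \<le> 1 / (5 * L)"
    and "0 < lam_min" and "lam_min < lam 0"
    and "\<And>k. lam_min \<le> lam k \<and> lam k \<le> lam 0"
    \<comment> \<open>truncated subtraction \<open>0 - 1 = 0\<close> realises the convention that the term of index \<open>-1\<close> equals the one of index \<open>0\<close>\<close>
    and "summable (\<lambda>k. \<bar>lam k - lam (k - 1)\<bar>)"
    and "\<And>k. 0 \<le> \<beta> k \<and> \<beta> k \<le> 1 / 4"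
    and "summable \<beta>"
    and "\<And>k. \<theta> k = 1 - \<beta> k"
    and "x 0 = u 0" and "u 0 \<in> C"
    and "\<And>k. x (Suc k) = metric_proj C (x k - lam k *\<^sub>R B (u k))"
    and "\<And>k. k \<ge> 1 \<Longrightarrow>
           u k = x k + \<theta> k *\<^sub>R (x k - x (k - 1)) + \<beta> k *\<^sub>R (x k - u (k - 1))"
  shows "(\<exists>z \<in> VI_solutions B C. converges_weakly x z) \<and>
         (\<lambda>k. norm (x (Suc k) - x k)) \<longlonglongrightarrow> 0 \<and>
         (\<lambda>k. norm (u k - x k)) \<longlonglongrightarrow> 0"
proof -
  note C = \<open>closed C\<close> \<open>convex C\<close> \<open>C \<noteq> {}\<close>
  note L = \<open>L > 0\<close>
  note u_rec = assms(20)
  have lam: "0 < lam k" "lam_min \<le> lam k" "lam k * L \<le> 1 / 5" for k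
  proof -
    show "0 < lam k" "lam_min \<le> lam k" using assms(12)[of k] \<open>0 < lam_min\<close> by auto
    have "lam k \<le> 1 / (5 * L)" using assms(12)[of k] \<open>lam 0 \<le> 1 / (5 * L)\<close> by linarith
    then show "lam k * L \<le> 1 / 5" using L by (simp add: field_simps)
  qed
  have b: "0 \<le> \<beta> k" "\<beta> k \<le> 1 / 4" for k using assms(14) by auto
  have lip: "norm (B p - B q) \<le> L * norm (p - q)" for p q
    using lipschitz_onD[OF \<open>L-lipschitz_on UNIV B\<close>, of p q] by (simp add: dist_norm)
  have mono: "0 \<le> inner (B p - B q) (p - q)" for p q
    using \<open>monotone_operator B\<close> by (simp add: monotone_operator_def)
  \<comment> \<open>The case of \<open>x 0\<close> matters: the energy step tests the projection
    inequality with the previous iterate.\<close>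
  have xC: "x k \<in> C" for k
  proof (cases k)
    case 0
    then show ?thesis using \<open>x 0 = u 0\<close> \<open>u 0 \<in> C\<close> by simp
  next
    case (Suc n)
    then show ?thesis using metric_proj_in[OF C] assms(19) by simp
  qed
  have proj: "0 \<le> inner (x (Suc k) - x k + lam k *\<^sub>R B (u k)) (y - x (Suc k))" if "y \<in> C" for k y
    using metric_proj_dot[OF C that, of "x k - lam k *\<^sub>R B (u k)"]
    unfolding assms(19)[of k, symmetric] by (simp add: algebra_simps)
  have u: "u (Suc k) = 2 *\<^sub>R x (Suc k) - x k + \<beta> (Suc k) *\<^sub>R (x k - u k)" for k
    using u_rec[of "Suc k"] by (simp add: assms(16) scaleR_2 algebra_simps)
  have Fejer: "convergent (\<lambda>k. (norm (x k - z))\<^sup>2)"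
      "(\<lambda>k. norm (x (Suc k) - x k)) \<longlonglongrightarrow> 0" "(\<lambda>k. norm (x (Suc k) - u k)) \<longlonglongrightarrow> 0"
    if z: "z \<in> VI_solutions B C" for z
  proof -
    have zC: "z \<in> C" and Bz: "0 \<le> inner (B z) (x k - z)" for k
      using z xC by (auto simp: VI_solutions_def)
    define r where "r k = inner (B z) (x k - z)" for k
    have r: "0 \<le> r k" for k using Bz by (simp add: r_def)
    \<comment> \<open>The pair \<open>x k\<close>, \<open>x (Suc k)\<close> is matched with
      \<open>u k\<close>, so the passage to \<open>E (Suc k)\<close> uses the recursion for
      \<open>u\<close> only at positive indices.\<close>
    define E where "E k = (norm (x (Suc k) - z))\<^sup>2 + 1/5 * (norm (x (Suc k) - u k))\<^sup>2
        + 1/10 * (norm (x (Suc k) - x k))\<^sup>2 + 2 * (lam k * r k)" for k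
    \<comment> \<open>This is what \<open>iteration_energy_step\<close> leaves after both energies
      are removed: 2/5 - 1/5, 3/5 + 1/10 and 4 - 2.\<close>
    define D where "D k = 1/5 * (norm (x (Suc (Suc k)) - u (Suc k)))\<^sup>2
        + 7/10 * (norm (x (Suc k) - x k))\<^sup>2 + 2 * (lam (Suc k) * r (Suc k))" for k
    define c where "c = 12 * (norm (B z) + L) + (norm (B z) + L) / L + 14"
    define \<delta> where "\<delta> k = 40 * c * (\<beta> (Suc k) + \<bar>lam (Suc k) - lam k\<bar>)" for k
    have lr: "0 \<le> lam k * r k" for k using lam(1)[of k] r[of k] by simp
    have c: "0 \<le> c" using L by (simp add: c_def)
    have E0: "0 \<le> E k" and D0: "0 \<le> D k" for k using lr[of k] lr[of "Suc k"] by (auto simp: E_def D_def)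
    have \<delta>0: "0 \<le> \<delta> k" for k using c b by (simp add: \<delta>_def)
    have "summable (\<lambda>k. \<bar>lam (Suc k) - lam k\<bar>)"
      using assms(13) by (subst (asm) summable_Suc_iff[symmetric]) simp
    then have \<delta>s: "summable \<delta>" unfolding \<delta>_def
      using \<open>summable \<beta>\<close> by (intro summable_mult summable_add) (simp_all add: summable_Suc_iff)
    have step: "E (Suc k) + D k \<le> E k + \<delta> k * (1 + E k)" for k
    proof -
      define N where "N = 1 + norm (x (Suc k) - z) + norm (x (Suc k) - x k) + norm (x (Suc k) - u k)"
      have sq: "(1 + p + q + s)\<^sup>2 \<le> 4 * (1 + p\<^sup>2 + q\<^sup>2 + s\<^sup>2)" for p q s :: real
        using sum_squares_bound[of 1 p] sum_squares_bound[of 1 q] sum_squares_bound[of 1 s]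
          sum_squares_bound[of p q] sum_squares_bound[of p s] sum_squares_bound[of q s]
        by (simp add: power2_eq_square algebra_simps)
      \<comment> \<open>Squaring a sum of four terms costs the factor 4, and the smallest weight
        1/10 in \<open>E\<close> the factor 10; controlling \<open>N\<close> is why \<open>E\<close>
        carries the increment of \<open>x\<close>.\<close>
      have "N\<^sup>2 \<le> 40 * (1 + E k)"
        using sq[of "norm (x (Suc k) - z)" "norm (x (Suc k) - x k)" "norm (x (Suc k) - u k)"]
          zero_le_power2[of "norm (x (Suc k) - z)"] zero_le_power2[of "norm (x (Suc k) - u k)"] lr[of k]
        unfolding N_def E_def distrib_left by linarith
      then have "(\<beta> (Suc k) + \<bar>lam (Suc k) - lam k\<bar>) * (c * N\<^sup>2)
          \<le> (\<beta> (Suc k) + \<bar>lam (Suc k) - lam k\<bar>) * (c * (40 * (1 + E k)))"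
        using c b by (intro mult_left_mono) auto
      also have "\<dots> = \<delta> k * (1 + E k)" by (simp add: \<delta>_def algebra_simps)
      finally have err: "(\<beta> (Suc k) + \<bar>lam (Suc k) - lam k\<bar>) * (c * N\<^sup>2) \<le> \<delta> k * (1 + E k)" .
      show ?thesis
        using iteration_energy_step[OF L lam(1)[of k] lam(3) lam(1)[of "Suc k"] lam(3) b u lip lip lip
            mono proj[OF xC] proj[OF xC] proj[OF zC] Bz Bz order_refl]
          err unfolding E_def D_def N_def c_def r_def by linarith
    qed
    have E: "convergent E" and D: "D \<longlonglongrightarrow> 0" using quasi_Fejer[OF E0 D0 \<delta>0 \<delta>s step] by auto
    have sum_bounds: "p \<le> 5 * (1/5 * p + 7/10 * q + 2 * s)" "q \<le> 5 * (1/5 * p + 7/10 * q + 2 * s)"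
      "s \<le> 5 * (1/5 * p + 7/10 * q + 2 * s)" if "0 \<le> p" "0 \<le> q" "0 \<le> s" for p q s :: real
      using that by simp_all
    have D_bounds: "(norm (x (Suc (Suc k)) - u (Suc k)))\<^sup>2 \<le> 5 * D k"
        "(norm (x (Suc k) - x k))\<^sup>2 \<le> 5 * D k" "lam (Suc k) * r (Suc k) \<le> 5 * D k" for k
      unfolding D_def by (rule sum_bounds; use lr in simp)+
    have zero: "f \<longlonglongrightarrow> 0" if "\<And>k. 0 \<le> f k" "\<And>k. f k \<le> 5 * D k" for f :: "nat \<Rightarrow> real"
      using tendsto_mult_left[OF D, of 5] that
      by (intro tendsto_sandwich[of "\<lambda>_. 0" f sequentially "\<lambda>k. 5 * D k"]) auto
    have d2: "(\<lambda>k. (norm (x (Suc k) - x k))\<^sup>2) \<longlonglongrightarrow> 0" by (rule zero[OF zero_le_power2 D_bounds(2)])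
    have s2: "(\<lambda>k. (norm (x (Suc k) - u k))\<^sup>2) \<longlonglongrightarrow> 0"
      by (rule LIMSEQ_imp_Suc, rule zero[OF zero_le_power2 D_bounds(1)])
    have lr0: "(\<lambda>k. lam k * r k) \<longlonglongrightarrow> 0"
      by (rule LIMSEQ_imp_Suc, rule zero[OF lr D_bounds(3)])
    from d2 tendsto_real_sqrt[OF this] show "(\<lambda>k. norm (x (Suc k) - x k)) \<longlonglongrightarrow> 0" by simp
    from s2 tendsto_real_sqrt[OF this] show "(\<lambda>k. norm (x (Suc k) - u k)) \<longlonglongrightarrow> 0" by simp
    obtain l where "E \<longlonglongrightarrow> l" using E by (auto simp: convergent_def)
    then have "(\<lambda>k. E k - 1/5 * (norm (x (Suc k) - u k))\<^sup>2 - 1/10 * (norm (x (Suc k) - x k))\<^sup>2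
        - 2 * (lam k * r k)) \<longlonglongrightarrow> l - 1/5 * 0 - 1/10 * 0 - 2 * 0"
      by (intro tendsto_intros d2 s2 lr0)
    then have "(\<lambda>k. (norm (x (Suc k) - z))\<^sup>2) \<longlonglongrightarrow> l" by (simp add: E_def)
    then have "(\<lambda>k. (norm (x k - z))\<^sup>2) \<longlonglongrightarrow> l" by (rule LIMSEQ_imp_Suc)
    then show "convergent (\<lambda>k. (norm (x k - z))\<^sup>2)" by (rule convergentI)
  qed
  obtain z where z: "z \<in> VI_solutions B C" using \<open>VI_solutions B C \<noteq> {}\<close> by blast
  note d0 = Fejer(2)[OF z] and s0 = Fejer(3)[OF z]
  have v0: "(\<lambda>k. norm (u k - x k)) \<longlonglongrightarrow> 0"
  proof (rule tendsto_sandwich[OF _ _ tendsto_const])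
    show "(\<lambda>k. norm (x (Suc k) - x k) + norm (x (Suc k) - u k)) \<longlonglongrightarrow> 0"
      using tendsto_add[OF d0 s0] by simp
    show "\<forall>\<^sub>F k in sequentially. norm (u k - x k) \<le> norm (x (Suc k) - x k) + norm (x (Suc k) - u k)"
      using norm_triangle_ineq4[of "x (Suc k) - x k" "x (Suc k) - u k" for k] by simp
  qed auto
  have bd: "bounded (range x)"
  proof -
    have "Bseq (\<lambda>k. (norm (x k - z))\<^sup>2)" using Fejer(1)[OF z] by (rule convergent_imp_Bseq)
    then obtain M where M: "(norm (x k - z))\<^sup>2 \<le> M" for k by (auto simp: Bseq_def)
    have "norm (x k) \<le> norm z + sqrt M" for k
      using real_le_rsqrt[OF M[of k]] norm_triangle_sub[of "x k" z] by linarith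
    then show ?thesis by (auto simp: bounded_iff)
  qed
  \<comment> \<open>An asymptotic Minty inequality, written as a half-space condition on
    \<open>x k\<close> so that it passes to closed convex hulls of tails. It joins the projection
    inequality at \<open>x (Suc k)\<close>, divided by \<open>lam k\<close>, to monotonicity between
    \<open>y\<close> and \<open>u k\<close>.\<close>
  have VI_limit: "\<exists>\<epsilon>. \<epsilon> \<longlonglongrightarrow> 0 \<and> (\<forall>k. inner (B y) (x k) \<le> inner (B y) y + \<epsilon> k)" if y: "y \<in> C" for y
  proof -
    obtain X where X: "norm (x k) \<le> X" for k using bd by (auto simp: bounded_iff)
    have "Bseq (\<lambda>k. norm (u k - x k))" using v0 by (auto intro: convergent_imp_Bseq convergentI)
    then obtain V where V: "norm (u k - x k) \<le> V" for k by (auto simp: Bseq_def)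
    define M where "M = X + norm y"
    define W where "W = norm (B 0) + L * (X + V)"
    have yx: "norm (y - x k) \<le> M" for k using norm_triangle_ineq4[of y "x k"] X[of k] by (simp add: M_def)
    have W: "norm (B (u k)) \<le> W" for k
    proof -
      have "norm (u k) \<le> X + V" using norm_triangle_sub[of "u k" "x k"] X[of k] V[of k] by linarith
      then have "norm (B (u k) - B 0) \<le> L * (X + V)"
        using lip[of "u k" 0] L by (simp add: order_trans)
      then show ?thesis using norm_triangle_sub[of "B (u k)" "B 0"] by (simp add: W_def)
    qed
    \<comment> \<open>The first term is where \<open>lam_min\<close> keeps the division by
      \<open>lam k\<close> harmless; the other two pay for passing from \<open>x (Suc k)\<close> to
      \<open>u k\<close> and from \<open>u k\<close> to \<open>x k\<close>.\<close>
    define \<epsilon> where "\<epsilon> k = norm (x (Suc k) - x k) * M / lam_min + W * norm (x (Suc k) - u k)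
        + norm (B y) * norm (u k - x k)" for k
    have "\<epsilon> \<longlonglongrightarrow> 0 * M / lam_min + W * 0 + norm (B y) * 0"
      unfolding \<epsilon>_def using \<open>0 < lam_min\<close> by (intro tendsto_intros d0 s0 v0) auto
    moreover have "inner (B y) (x k) \<le> inner (B y) y + \<epsilon> k" for k
    proof -
      let ?d = "x (Suc k) - x k"
      have "0 \<le> inner ?d (y - x (Suc k)) + lam k * inner (B (u k)) (y - x (Suc k))"
        using proj[OF y, of k] by (simp add: inner_add_left)
      moreover have dM: "inner ?d (y - x (Suc k)) \<le> norm ?d * M"
        using norm_cauchy_schwarz[of ?d "y - x (Suc k)"] mult_left_mono[OF yx, of "norm ?d" "Suc k"] by simp
      ultimately have "- inner (B (u k)) (y - x (Suc k)) \<le> norm ?d * M / lam k"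
        using lam(1)[of k] by (simp add: field_simps)
      also have "\<dots> \<le> norm ?d * M / lam_min"
        using lam(2)[of k] \<open>0 < lam_min\<close> yx[of k] by (intro divide_left_mono mult_nonneg_nonneg mult_pos_pos)
          (auto intro: order_trans[OF norm_ge_zero] lam)
      finally have 1: "- inner (B (u k)) (y - x (Suc k)) \<le> norm ?d * M / lam_min" .
      have "- inner (B (u k)) (x (Suc k) - u k) \<le> norm (B (u k)) * norm (x (Suc k) - u k)"
        using norm_cauchy_schwarz[of "- B (u k)"] unfolding inner_minus_left norm_minus_cancel .
      also have "\<dots> \<le> W * norm (x (Suc k) - u k)" using W by (intro mult_right_mono) auto
      finally have 2: "- inner (B (u k)) (x (Suc k) - u k) \<le> W * norm (x (Suc k) - u k)" .
      have 3: "- inner (B y) (u k - x k) \<le> norm (B y) * norm (u k - x k)"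
        using norm_cauchy_schwarz[of "- B y"] unfolding inner_minus_left norm_minus_cancel .
      have "inner (B y) (x k) - inner (B y) y = - inner (B (u k)) (y - x (Suc k))
          - inner (B (u k)) (x (Suc k) - u k) - inner (B y) (u k - x k) - inner (B y - B (u k)) (y - u k)"
        by (simp add: inner_simps)
      then show ?thesis using 1 2 3 mono[of y "u k"] unfolding \<epsilon>_def by linarith
    qed
    ultimately show ?thesis by auto
  qed
  have "\<exists>z\<in>VI_solutions B C. converges_weakly x z"
  proof (rule weak_convergence_Opial[OF bd Fejer(1)])
    fix q assume q: "\<And>n. q \<in> closure (convex hull (x ` {n..}))"
    have "q \<in> C" using q[of 0] closure_convex_hull_subset[OF C(1,2), of "{0..}" x] xC by auto
    moreover have "inner (B y) q \<le> inner (B y) y" if y: "y \<in> C" for y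
    proof (rule field_le_epsilon)
      fix e :: real assume "0 < e"
      obtain \<epsilon> where "\<epsilon> \<longlonglongrightarrow> 0" and \<epsilon>: "inner (B y) (x k) \<le> inner (B y) y + \<epsilon> k" for k
        using VI_limit[OF y] by blast
      then have "\<forall>\<^sub>F k in sequentially. \<epsilon> k < e" using \<open>0 < e\<close> by (intro order_tendstoD(2))
      then obtain n where n: "\<epsilon> k < e" if "k \<ge> n" for k by (auto simp: eventually_sequentially)
      \<comment> \<open>A whole tail lies in this closed half-space, which therefore contains
        \<open>q\<close>.\<close>
      have "x k \<in> {w. inner (B y) w \<le> inner (B y) y + e}" if "k \<in> {n..}" for k
        using n[of k] \<epsilon>[of k] that by simp
      then show "inner (B y) q \<le> inner (B y) y + e"
        using closure_convex_hull_subset[OF closed_halfspace_le convex_halfspace_le] q by blast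
    qed
    ultimately show "q \<in> VI_solutions B C"
      by (intro Minty_VI[OF \<open>convex C\<close>]) (use \<open>L-lipschitz_on UNIV B\<close> lipschitz_on_continuous_on in \<open>auto simp: inner_diff_right\<close>)
  qed
  then show ?thesis using d0 v0 by blast
qed

end
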